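(* Let $n \geq 8$ be even, let $\tau_n := (1, 2, 3, n, n-1, n-2, \ldots, 6, 5, 4)$ be a cyclic order on $\{1,\ldots,n\}$, and let $c_n$ be the edge-coloring of $C(n,\{1,3\})$ with colors red, blue, green, purple defined in the context. Then $(C(n,\{1,3\}), \tau_n, c_n)$ is a dispersable matching book embedding.
   Context: All graphs are finite and simple. Write $[k]=\{1,\ldots,k\}$ (so $[0]=\emptyset$). For a set $S=\{i_1<\cdots<i_k\}$ of integers with $k\ge 1$, $1\le i_1$ and $i_k\le \lfloor n/2\rfloor$, the circulant $C(n,S)$ is the graph on vertex set $[n]$ in which each $j$ is adjacent to $j+i_r$ (addition mod $n$) for $r=1,\ldots,k$. Given a graph $G$ and a cyclic order $\omega$ on $V(G)$, draw the vertices on a circle in the order $\omega$ and the edges as straight chords; two edges cross if they intersect at a point that is not an endpoint. A matching book embedding $(G,\omega,c)$ consists of $G$, a cyclic order $\omega$, and an edge-coloring $c$ (the color classes are the pages) such that any two distinct edges of the same color neither cross nor share an endpoint. It is dispersable if the number of colors equals the maximum degree $\Delta(G)$. Write $u{-}v$ for the edge joining $u$ and $v$. The coloring $c_n$ is as follows. First, the 10 "twist" edges are colored: Red: $1{-}2$, $3{-}4$. Blue: $2{-}3$, $1{-}n$. Green: $3{-}n$, $2{-}(n-1)$, $1{-}(n-2)$. Purple: $1{-}4$, $2{-}5$, $3{-}6$. The remaining edges are colored as follows. Case $n=4k$, $k\ge 2$: Blue: $a{-}(a+3)$ and $(a+1){-}(a+2)$ for $a=4t$, $t\in[k-1]$.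 Red: $a{-}(a+3)$ and $(a+1){-}(a+2)$ for $a=1+4t$, $t\in[k-1]$. Green: $a{-}(a+3)$ and $(a+1){-}(a+2)$ for $a=2+4t$, $t\in[k-2]$, and also $4{-}5$. Purple: $a{-}(a+3)$ and $(a+1){-}(a+2)$ for $a=3+4t$, $t\in[k-2]$, and also $(n-1){-}n$. Case $n=4k+2$, $k\ge 2$: Green: $a{-}(a+3)$ and $(a+1){-}(a+2)$ for $a=4t$, $t\in[k-1]$. Red: $a{-}(a+3)$ and $(a+1){-}(a+2)$ for $a=1+4t$, $t\in[k-1]$, and also $(n-1){-}n$. Blue: $a{-}(a+3)$ and $(a+1){-}(a+2)$ for $a=2+4t$, $t\in[k-1]$, and also $4{-}5$. Purple: $a{-}(a+3)$ and $(a+1){-}(a+2)$ for $a=3+4t$, $t\in[k-1]$. *)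

theory Defs
  imports "HOL-Analysis.Analysis"
begin

record 'a ugraph =
  verts :: "'a set"
  edges :: "'a set set"

definition simple_graph :: "'a ugraph \<Rightarrow> bool" where
  "simple_graph G \<longleftrightarrow>
     finite (verts G) \<and> (\<forall>e \<in> edges G. e \<subseteq> verts G \<and> card e = 2)"

definition degree :: "'a ugraph \<Rightarrow> 'a \<Rightarrow> nat" where
  "degree G v = card {e \<in> edges G. v \<in> e}"

definition max_degree :: "'a ugraph \<Rightarrow> nat" where
  "max_degree G = Max (degree G ` verts G)"

(* The residues modulo n are represented by 1, ..., n, hence the shift by one. The graph is
   meant for nonempty S contained in {1..n div 2}. *)
definition circulant :: "nat \<Rightarrow> nat set \<Rightarrow> nat ugraph" where
  "circulant n S =
     \<lparr>verts = {1..n}, edges = {{j, (j + i - 1) mod n + 1} | j i. j \<in> {1..n} \<and> i \<in> S}\<rparr>"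

(* A cyclic order on V is given by a list enumerating V without repetition; lists that differ
   by a rotation denote the same cyclic order (and have the same circular drawings). *)
definition cyclic_order_on :: "'a set \<Rightarrow> 'a list \<Rightarrow> bool" where
  "cyclic_order_on V \<omega> \<longleftrightarrow> distinct \<omega> \<and> set \<omega> = V"

(* p places the vertices on the unit circle, counterclockwise in the order given by the list:
   the angles increase along the list and span less than one full turn. *)
definition circular_drawing :: "'a list \<Rightarrow> ('a \<Rightarrow> complex) \<Rightarrow> bool" where
  "circular_drawing \<omega> p \<longleftrightarrow>
     (\<exists>\<theta> :: nat \<Rightarrow> real.
        (\<forall>i j. i < j \<and> j < length \<omega> \<longrightarrow> \<theta> i < \<theta> j \<and> \<theta> j < \<theta> i + 2 * pi) \<and>
        (\<forall>i < length \<omega>. p (\<omega> ! i) = cis (\<theta> i)))"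

(* For an edge e = {u, v}, the set convex hull (p ` e) is the straight chord from p u to p v. *)
definition chords_cross :: "('a \<Rightarrow> complex) \<Rightarrow> 'a set \<Rightarrow> 'a set \<Rightarrow> bool" where
  "chords_cross p e f \<longleftrightarrow>
     (\<exists>z \<in> convex hull (p ` e) \<inter> convex hull (p ` f). z \<notin> p ` e \<union> p ` f)"

(* Whether two distinct edges cross does not depend on the circular drawing; a matching book
   embedding below is thus required to be free of crossings in every circular drawing. *)
definition edges_cross :: "'a list \<Rightarrow> 'a set \<Rightarrow> 'a set \<Rightarrow> bool" where
  "edges_cross \<omega> e f \<longleftrightarrow> (\<exists>p. circular_drawing \<omega> p \<and> chords_cross p e f)"

(* Circular drawings exist, so the absence of crossings is never vacuous. *)
lemma circular_drawing_exists:
  assumes "distinct \<omega>"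
  shows "\<exists>p. circular_drawing \<omega> p"
proof -
  define \<theta> :: "nat \<Rightarrow> real" where "\<theta> i = 2 * pi * (real i / real (length \<omega>))" for i
  define p where "p v = cis (\<theta> (THE i. i < length \<omega> \<and> \<omega> ! i = v))" for v
  have "p (\<omega> ! i) = cis (\<theta> i)" if "i < length \<omega>" for i
  proof -
    have "(THE j. j < length \<omega> \<and> \<omega> ! j = \<omega> ! i) = i"
      using assms that by (intro the_equality) (auto simp: nth_eq_iff_index_eq)
    then show ?thesis by (simp add: p_def)
  qed
  moreover have "\<theta> i < \<theta> j \<and> \<theta> j < \<theta> i + 2 * pi" if "i < j" "j < length \<omega>" for i j
  proof -
    have "real i / real (length \<omega>) < real j / real (length \<omega>)"
      using that by (intro divide_strict_right_mono) auto
    moreover have "real j / real (length \<omega>) < 1"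
      using that by (simp add: divide_less_eq)
    moreover have "0 \<le> real i / real (length \<omega>)"
      by simp
    ultimately have "real i / real (length \<omega>) < real j / real (length \<omega>)"
      and "real j / real (length \<omega>) < real i / real (length \<omega>) + 1"
      by linarith+
    then have "2 * pi * (real i / real (length \<omega>)) < 2 * pi * (real j / real (length \<omega>))"
      and "2 * pi * (real j / real (length \<omega>)) < 2 * pi * (real i / real (length \<omega>) + 1)"
      by (intro mult_strict_left_mono; simp)+
    then show ?thesis
      unfolding \<theta>_def by (simp only: distrib_left mult_1_right simp_thms)
  qed
  ultimately show ?thesis
    unfolding circular_drawing_def by blast
qed

(* An edge-coloring is given by its color classes: C x is the set of edges of color x, and
   every edge has exactly one color. *)
definition edge_coloring :: "'a ugraph \<Rightarrow> ('c \<Rightarrow> 'a set set) \<Rightarrow> bool" where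
  "edge_coloring G C \<longleftrightarrow>
     (\<Union>x. C x) = edges G \<and> (\<forall>x y. x \<noteq> y \<longrightarrow> C x \<inter> C y = {})"

definition matching_book_embedding ::
  "'a ugraph \<Rightarrow> 'a list \<Rightarrow> ('c \<Rightarrow> 'a set set) \<Rightarrow> bool" where
  "matching_book_embedding G \<omega> C \<longleftrightarrow>
     simple_graph G \<and> cyclic_order_on (verts G) \<omega> \<and> edge_coloring G C \<and>
     (\<forall>x. \<forall>e \<in> C x. \<forall>f \<in> C x. e \<noteq> f \<longrightarrow> \<not> edges_cross \<omega> e f \<and> e \<inter> f = {})"

definition dispersable :: "'a ugraph \<Rightarrow> 'a list \<Rightarrow> ('c \<Rightarrow> 'a set set) \<Rightarrow> bool" where
  "dispersable G \<omega> C \<longleftrightarrow>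
     matching_book_embedding G \<omega> C \<and> card {x. C x \<noteq> {}} = max_degree G"

datatype color = Red | Blue | Green | Purple

fun twist_edges :: "nat \<Rightarrow> color \<Rightarrow> nat set set" where
  "twist_edges n Red = {{1, 2}, {3, 4}}"
| "twist_edges n Blue = {{2, 3}, {1, n}}"
| "twist_edges n Green = {{3, n}, {2, n - 1}, {1, n - 2}}"
| "twist_edges n Purple = {{1, 4}, {2, 5}, {3, 6}}"

(* The edges a-(a+3) and (a+1)-(a+2) for a = r + 4 * t, where t ranges over 1, ..., m. *)
definition nested_pairs :: "nat \<Rightarrow> nat \<Rightarrow> nat set set" where
  "nested_pairs r m = (\<Union>t \<in> {1..m}. let a = r + 4 * t in {{a, a + 3}, {a + 1, a + 2}})"

(* The remaining edges for n = 4 * k. *)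
fun rest_edges_0 :: "nat \<Rightarrow> nat \<Rightarrow> color \<Rightarrow> nat set set" where
  "rest_edges_0 n k Blue = nested_pairs 0 (k - 1)"
| "rest_edges_0 n k Red = nested_pairs 1 (k - 1)"
| "rest_edges_0 n k Green = nested_pairs 2 (k - 2) \<union> {{4, 5}}"
| "rest_edges_0 n k Purple = nested_pairs 3 (k - 2) \<union> {{n - 1, n}}"

(* The remaining edges for n = 4 * k + 2. *)
fun rest_edges_2 :: "nat \<Rightarrow> nat \<Rightarrow> color \<Rightarrow> nat set set" where
  "rest_edges_2 n k Green = nested_pairs 0 (k - 1)"
| "rest_edges_2 n k Red = nested_pairs 1 (k - 1) \<union> {{n - 1, n}}"
| "rest_edges_2 n k Blue = nested_pairs 2 (k - 1) \<union> {{4, 5}}"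
| "rest_edges_2 n k Purple = nested_pairs 3 (k - 1)"

(* The coloring c_n, for even n \<ge> 8; in both cases k = n div 4. *)
definition circulant_coloring :: "nat \<Rightarrow> color \<Rightarrow> nat set set" where
  "circulant_coloring n x =
     twist_edges n x \<union>
     (if n mod 4 = 0 then rest_edges_0 n (n div 4) x else rest_edges_2 n (n div 4) x)"

(* The cyclic order \<tau>_n = (1, 2, 3, n, n - 1, ..., 5, 4). *)
definition twist_order :: "nat \<Rightarrow> nat list" where
  "twist_order n = [1, 2, 3] @ rev [4..<n + 1]"

end

theory Submission
  imports Defs
begin

text \<open>The vertices above 3 appear in the order \<open>\<tau>\<^sub>n\<close> in reverse, so each pair of nested edges
  occupies a block of four consecutive vertices, and an edge with both ends outside a block cannot
  cross an edge inside it. Within a color the blocks are disjoint and avoid the few other edges,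
  which are pairwise nested or separated. The graph has maximum degree 4: a vertex has at most one
  edge of each color, and vertex 1 has four neighbors.\<close>

section \<open>Chords of a circle and a combinatorial non-crossing criterion\<close>

lemma cos_greater_inside:
  fixes h x :: real
  assumes "\<bar>x\<bar> < h" and "h < pi"
  shows "cos h < cos x"
  using cos_monotone_0_pi[of "\<bar>x\<bar>" h] assms by simp

text \<open>Cosine is not monotone on this range. The difference \<open>cos h - cos x\<close>
  factors into two sines whose arguments \<open>(h + x) / 2\<close> and \<open>(x - h) / 2\<close>
  both lie strictly between 0 and \<open>pi\<close>.\<close>

lemma cos_less_outside:
  fixes h x :: real
  assumes "0 < h" and "h < x" and "x < 2 * pi - h"
  shows "cos x < cos h"
proof -
  have "0 < sin ((h + x) / 2)" and "0 < sin ((x - h) / 2)"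
    using assms by (auto intro!: sin_gt_zero)
  then have "0 < 2 * sin ((h + x) / 2) * sin ((x - h) / 2)" by simp
  then show ?thesis
    by (simp only: cos_diff_cos[of h x, symmetric] diff_gt_0_iff_gt)
qed

text \<open>The functional \<open>z \<mapsto> z \<bullet> cis m\<close>, with \<open>m\<close> the mean of the two angles of the first chord, is
  constant on that chord and separates the two arcs it cuts off.\<close>

lemma not_edges_cross_nth:
  fixes \<omega> :: "'a list"
  assumes len: "a < length \<omega>" "b < length \<omega>" "c < length \<omega>" "d < length \<omega>"
    and ne: "a \<noteq> b" "c \<notin> {a, b}" "d \<notin> {a, b}"
    and side: "((a < c) = (b < c)) = ((a < d) = (b < d))"
  shows "\<not> edges_cross \<omega> {\<omega> ! a, \<omega> ! b} {\<omega> ! c, \<omega> ! d}"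
  using len ne side
proof (induction a b rule: linorder_wlog)
  case (sym a b)
  have "\<not> edges_cross \<omega> {\<omega> ! b, \<omega> ! a} {\<omega> ! c, \<omega> ! d}"
    using sym.prems by (intro sym(1)) auto
  then show ?case by (simp add: insert_commute)
next
  case (le a b)
  then have ab: "a < b" by simp
  show ?case
  proof
    assume "edges_cross \<omega> {\<omega> ! a, \<omega> ! b} {\<omega> ! c, \<omega> ! d}"
    then obtain p z where "circular_drawing \<omega> p"
      and z1: "z \<in> convex hull {p (\<omega> ! a), p (\<omega> ! b)}"
      and z2: "z \<in> convex hull {p (\<omega> ! c), p (\<omega> ! d)}"
      unfolding edges_cross_def chords_cross_def by auto
    then obtain \<theta> :: "nat \<Rightarrow> real"
      where \<theta>: "\<And>i j. i < j \<Longrightarrow> j < length \<omega> \<Longrightarrow> \<theta> i < \<theta> j \<and> \<theta> j < \<theta> i + 2 * pi"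
        and p: "\<And>i. i < length \<omega> \<Longrightarrow> p (\<omega> ! i) = cis (\<theta> i)"
      unfolding circular_drawing_def by blast
    \<comment> \<open>The ends of the first chord have angles \<open>m - h\<close> and
      \<open>m + h\<close>, so the functional takes the value \<open>cos h\<close> at both.\<close>
    define m h where "m = (\<theta> a + \<theta> b) / 2" and "h = (\<theta> b - \<theta> a) / 2"
    have h: "0 < h" "h < pi" and m: "\<theta> a = m - h" "\<theta> b = m + h"
      using \<theta>[OF ab le.prems(2)] by (simp_all add: m_def h_def field_simps)
    have L: "cis m \<bullet> p (\<omega> ! i) = cos (\<theta> i - m)" if "i < length \<omega>" for i
      using that by (simp add: p inner_complex_def cos_diff mult.commute)
    have inside: "cos h < cis m \<bullet> p (\<omega> ! i)" if i: "a < i" "i < b" for i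
    proof -
      have len: "i < length \<omega>" using i le.prems(2) by simp
      have "\<bar>\<theta> i - m\<bar> < h"
        using \<theta>[OF i(1) len] \<theta>[OF i(2) le.prems(2)] m by linarith
      with h show ?thesis by (simp add: L[OF len] cos_greater_inside)
    qed
    have outside: "cis m \<bullet> p (\<omega> ! i) < cos h" if i: "i < a \<or> b < i" and len: "i < length \<omega>" for i
    proof -
      \<comment> \<open>The lower bound is monotonicity of the angles; the upper bound holds because
        they span less than a full turn, applied to \<open>i\<close> and the farther of
        \<open>a\<close> and \<open>b\<close>.\<close>
      from i have "h < \<bar>\<theta> i - m\<bar> \<and> \<bar>\<theta> i - m\<bar> < 2 * pi - h"
      proof
        assume "i < a"
        with \<theta>[of i a] \<theta>[of i b] le.prems(1,2) ab m show ?thesis by simp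
      next
        assume "b < i"
        with \<theta>[of a i] \<theta>[of b i] len ab m show ?thesis by simp
      qed
      with h have "cos \<bar>\<theta> i - m\<bar> < cos h" by (intro cos_less_outside) auto
      then show ?thesis by (simp add: L[OF len])
    qed
    have "convex hull {p (\<omega> ! a), p (\<omega> ! b)} \<subseteq> {z. cis m \<bullet> z = cos h}"
      using le.prems(1,2) by (intro hull_minimal convex_hyperplane) (simp add: L m)
    with z1 have on: "cis m \<bullet> z = cos h" by auto
    \<comment> \<open>As \<open>a < b\<close>, the equation \<open>(a < c) = (b < c)\<close> says
      that \<open>c\<close> lies outside the interval from \<open>a\<close> to \<open>b\<close>.
      Thus \<open>side\<close> puts \<open>c\<close> and \<open>d\<close> on the same arc, and their
      chord lies in an open half-plane that misses the line containing \<open>z\<close>.\<close>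
    have "(a < c \<and> c < b \<and> a < d \<and> d < b) \<or> ((c < a \<or> b < c) \<and> (d < a \<or> b < d))"
      using le.prems(5-8) ab by auto
    then show False
    proof
      assume "a < c \<and> c < b \<and> a < d \<and> d < b"
      then have "convex hull {p (\<omega> ! c), p (\<omega> ! d)} \<subseteq> {z. cis m \<bullet> z > cos h}"
        using inside by (intro hull_minimal convex_halfspace_gt) auto
      with z2 on show False by auto
    next
      assume "(c < a \<or> b < c) \<and> (d < a \<or> b < d)"
      then have "convex hull {p (\<omega> ! c), p (\<omega> ! d)} \<subseteq> {z. cis m \<bullet> z < cos h}"
        using outside le.prems by (intro hull_minimal convex_halfspace_lt) auto
      with z2 on show False by auto
    qed
  qed
qed

section \<open>Edges of one color in the twisted order\<close>

definition independent_edges :: "'a list \<Rightarrow> 'a set \<Rightarrow> 'a set \<Rightarrow> bool" where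
  "independent_edges \<omega> e f \<longleftrightarrow> \<not> edges_cross \<omega> e f \<and> e \<inter> f = {}"

lemma independent_edges_commute: "independent_edges \<omega> e f = independent_edges \<omega> f e"
  unfolding independent_edges_def edges_cross_def chords_cross_def
  by (simp add: Int_commute Un_commute)

text \<open>By symmetry, an explicitly listed set needs only one check per unordered pair of
  edges.\<close>

lemma pairwise_independent_insert:
  "pairwise (independent_edges \<omega>) (insert e S) \<longleftrightarrow>
     (\<forall>f \<in> S. f \<noteq> e \<longrightarrow> independent_edges \<omega> e f) \<and> pairwise (independent_edges \<omega>) S"
  by (auto simp: pairwise_insert independent_edges_commute[of \<omega> _ e])

text \<open>The index of vertex \<open>v\<close> in \<open>twist_order n\<close>, counted from 0:
  vertex \<open>n\<close> has index 3 and vertex 4 has index \<open>n - 1\<close>.\<close>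

definition twist_pos :: "nat \<Rightarrow> nat \<Rightarrow> nat" where
  "twist_pos n v = (if v \<le> 3 then v - 1 else n + 3 - v)"

lemma length_twist_order: "n \<ge> 3 \<Longrightarrow> length (twist_order n) = n"
  by (simp add: twist_order_def del: upt_Suc)

lemma twist_order_nth_pos:
  assumes "v \<in> {1..n}" and "n \<ge> 3"
  shows "twist_pos n v < n" and "twist_order n ! twist_pos n v = v"
proof -
  show "twist_pos n v < n" using assms by (auto simp: twist_pos_def)
  have "v = 1 \<or> v = 2 \<or> v = 3 \<or> v \<ge> 4" using assms by auto
  then show "twist_order n ! twist_pos n v = v"
    using assms
    by (elim disjE) (simp_all add: twist_order_def twist_pos_def nth_append rev_nth del: upt_Suc)
qed

lemma cyclic_order_twist: "n \<ge> 3 \<Longrightarrow> cyclic_order_on {1..n} (twist_order n)"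
  by (auto simp: cyclic_order_on_def twist_order_def)

text \<open>Passing from list indices to vertices turns non-crossing into linear arithmetic on
  \<open>twist_pos\<close>.\<close>

lemma independent_edges_twistI:
  assumes "n \<ge> 3" and V: "{u, v, x, y} \<subseteq> {1..n}" and "u \<noteq> v" and "{u, v} \<inter> {x, y} = {}"
    and "((twist_pos n u < twist_pos n x) = (twist_pos n v < twist_pos n x)) =
      ((twist_pos n u < twist_pos n y) = (twist_pos n v < twist_pos n y))"
  shows "independent_edges (twist_order n) {u, v} {x, y}"
proof -
  have nth: "twist_order n ! twist_pos n w = w" "twist_pos n w < n" if "w \<in> {u, v, x, y}" for w
    using twist_order_nth_pos[of w n] that assms(1) V by auto
  then have inj: "twist_pos n w \<noteq> twist_pos n w'"
    if "w \<in> {u, v, x, y}" "w' \<in> {u, v, x, y}" "w \<noteq> w'" for w w'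
    using that by metis
  have "\<not> edges_cross (twist_order n)
    {twist_order n ! twist_pos n u, twist_order n ! twist_pos n v}
    {twist_order n ! twist_pos n x, twist_order n ! twist_pos n y}"
    using assms nth(2) inj
    by (intro not_edges_cross_nth) (simp_all add: length_twist_order)
  then show ?thesis
    using assms(4) by (simp add: nth independent_edges_def)
qed

text \<open>An interval of vertices above 3 is contiguous in the twisted order, hence not separated by
  an edge with both ends outside.\<close>

lemma independent_edges_block:
  assumes "n \<ge> 3" and "4 \<le> lo" and "hi \<le> n" and "u \<in> {lo..hi}" and "v \<in> {lo..hi}"
    and "x \<in> {1..n} - {lo..hi}" and "y \<in> {1..n} - {lo..hi}" and "x \<noteq> y"
  shows "independent_edges (twist_order n) {x, y} {u, v}"
  using assms by (intro independent_edges_twistI) (auto simp: twist_pos_def)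

lemma nested_pairsE:
  assumes "e \<in> nested_pairs r m"
  obtains t i j where "t \<in> {1..m}" and "e = {r + 4 * t + i, r + 4 * t + j}"
    and "(i, j) = (0, 3) \<or> (i, j) = (1, 2)"
proof -
  from assms obtain t where "t \<in> {1..m}"
    and "e = {r + 4 * t + 0, r + 4 * t + 3} \<or> e = {r + 4 * t + 1, r + 4 * t + 2}"
    unfolding nested_pairs_def Let_def by auto
  with that[of t 0 3] that[of t 1 2] show thesis by blast
qed

lemma pairwise_independent_nested_pairs:
  assumes "r + 4 * m + 3 \<le> n"
  shows "pairwise (independent_edges (twist_order n)) (nested_pairs r m)"
proof (rule pairwiseI)
  fix e f
  assume "e \<in> nested_pairs r m" and "f \<in> nested_pairs r m" and ne: "e \<noteq> f"
  then obtain s t i j k l where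
    e: "s \<in> {1..m}" "e = {r + 4 * s + i, r + 4 * s + j}" "(i, j) = (0, 3) \<or> (i, j) = (1, 2)" and
    f: "t \<in> {1..m}" "f = {r + 4 * t + k, r + 4 * t + l}" "(k, l) = (0, 3) \<or> (k, l) = (1, 2)"
    by (elim nested_pairsE) blast
  have n: "n \<ge> 3" using e assms by auto
  \<comment> \<open>Distinct edges lie in different blocks, or are the outer and inner edge of one
    block. In the first case the block of \<open>f\<close> separates them; in the others the two
    middle vertices form an interval that avoids the outer edge.\<close>
  consider "s \<noteq> t" | "s = t" "(i, j) = (0, 3)" "(k, l) = (1, 2)" |
    "s = t" "(i, j) = (1, 2)" "(k, l) = (0, 3)"
    using e f ne by auto
  then show "independent_edges (twist_order n) e f"
  proof cases
    case 1
    then have "s < t \<or> t < s" by auto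
    with e f n assms show ?thesis unfolding e(2) f(2)
      by (intro independent_edges_block[where lo = "r + 4 * t" and hi = "r + 4 * t + 3"]) auto
  next
    case 2
    with e f n assms show ?thesis unfolding e(2) f(2)
      by (intro independent_edges_block[where lo = "r + 4 * t + 1" and hi = "r + 4 * t + 2"]) auto
  next
    case 3
    with e f n assms show ?thesis unfolding e(2) f(2)
      by (subst independent_edges_commute,
          intro independent_edges_block[where lo = "r + 4 * t + 1" and hi = "r + 4 * t + 2"]) auto
  qed
qed

text \<open>The blocks for \<open>t = 1, ..., m\<close> fill exactly the interval from
  \<open>r + 4\<close> to \<open>r + 4 * m + 3\<close>, so edges of \<open>S\<close> with both ends
  outside it are independent of all nested pairs at once. The interval is empty for
  \<open>m = 0\<close>, which occurs for green and purple when \<open>n = 8\<close>.\<close>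

lemma pairwise_independent_Un_nested_pairs:
  assumes C: "C = S \<union> nested_pairs r m" and r: "r + 4 * m + 3 \<le> n"
    and S: "pairwise (independent_edges (twist_order n)) S"
    and S_sub: "\<And>e. e \<in> S \<Longrightarrow> card e = 2 \<and> e \<subseteq> {1..n} - {r + 4..r + 4 * m + 3}"
  shows "pairwise (independent_edges (twist_order n)) C"
proof -
  have "independent_edges (twist_order n) e f" if "e \<in> S" and "f \<in> nested_pairs r m" for e f
  proof -
    from S_sub[OF that(1)] obtain x y where e: "e = {x, y}" "x \<noteq> y"
      and xy: "x \<in> {1..n} - {r + 4..r + 4 * m + 3}" "y \<in> {1..n} - {r + 4..r + 4 * m + 3}"
      by (auto simp: card_2_iff)
    from that(2) obtain t i j where
      f: "t \<in> {1..m}" "f = {r + 4 * t + i, r + 4 * t + j}" "(i, j) = (0, 3) \<or> (i, j) = (1, 2)"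
      by (rule nested_pairsE)
    show ?thesis
      unfolding e(1) f(2)
      by (rule independent_edges_block[where lo = "r + 4" and hi = "r + 4 * m + 3"])
        (use e(2) xy f r in auto)
  qed
  with S pairwise_independent_nested_pairs[OF r] show ?thesis
    unfolding C pairwise_def by (metis UnE independent_edges_commute)
qed

text \<open>Writing \<open>k = l + 2\<close> turns the truncated differences \<open>k - 1\<close>
  and \<open>k - 2\<close> into \<open>l + 1\<close> and \<open>l\<close>.\<close>

lemma circulant_coloring_cases:
  fixes n :: nat
  assumes "n \<ge> 8" and "even n"
  obtains l where "n = 4 * (l + 2)"
    and "\<And>x. circulant_coloring n x = twist_edges n x \<union> rest_edges_0 n (l + 2) x"
  | l where "n = 4 * (l + 2) + 2"
    and "\<And>x. circulant_coloring n x = twist_edges n x \<union> rest_edges_2 n (l + 2) x"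
proof -
  have "2 \<le> n div 4" using \<open>n \<ge> 8\<close> by (simp add: less_eq_div_iff_mult_less_eq)
  then obtain l where l: "n div 4 = l + 2" by (metis le_add_diff_inverse2)
  have "n mod 4 = 0 \<or> n mod 4 = 2" using \<open>even n\<close> by presburger
  then show thesis
  proof
    assume "n mod 4 = 0"
    moreover from this l have "n = 4 * (l + 2)" by (metis add.right_neutral mult_div_mod_eq)
    ultimately show thesis using l that(1) by (simp add: circulant_coloring_def)
  next
    assume "n mod 4 = 2"
    moreover from this l have "n = 4 * (l + 2) + 2" by (metis mult_div_mod_eq)
    ultimately show thesis using l that(2) by (simp add: circulant_coloring_def)
  qed
qed

text \<open>Outside its blocks each class has at most four edges, collected in \<open>S\<close>.
  Their ends are constants or \<open>n\<close> minus a constant, so finitely many comparisons settle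
  all \<open>n\<close>.\<close>

lemma pairwise_independent_circulant_coloring:
  assumes "n \<ge> 8" and "even n"
  shows "pairwise (independent_edges (twist_order n)) (circulant_coloring n x)"
  using assms
proof (cases rule: circulant_coloring_cases)
  case (1 l)
  show ?thesis
  proof (cases x)
    case Red
    show ?thesis unfolding Red 1(2)
      by (rule pairwise_independent_Un_nested_pairs
            [where S = "twist_edges n Red \<union> {}" and r = 1 and m = "l + 1"])
        (use 1(1) in \<open>auto simp: pairwise_independent_insert independent_edges_twistI
          twist_pos_def\<close>)
  next
    case Blue
    show ?thesis unfolding Blue 1(2)
      by (rule pairwise_independent_Un_nested_pairs
            [where S = "twist_edges n Blue \<union> {}" and r = 0 and m = "l + 1"])
        (use 1(1) in \<open>auto simp: pairwise_independent_insert independent_edges_twistI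
          twist_pos_def\<close>)
  next
    case Green
    show ?thesis unfolding Green 1(2)
      by (rule pairwise_independent_Un_nested_pairs
            [where S = "twist_edges n Green \<union> {{4, 5}}" and r = 2 and m = l])
        (use 1(1) in \<open>auto simp: pairwise_independent_insert independent_edges_twistI
          twist_pos_def\<close>)
  next
    case Purple
    show ?thesis unfolding Purple 1(2)
      by (rule pairwise_independent_Un_nested_pairs
            [where S = "twist_edges n Purple \<union> {{n - 1, n}}" and r = 3 and m = l])
        (use 1(1) in \<open>auto simp: pairwise_independent_insert independent_edges_twistI
          twist_pos_def\<close>)
  qed
next
  case (2 l)
  show ?thesis
  proof (cases x)
    case Red
    show ?thesis unfolding Red 2(2)
      by (rule pairwise_independent_Un_nested_pairs
            [where S = "twist_edges n Red \<union> {{n - 1, n}}" and r = 1 and m = "l + 1"])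
        (use 2(1) in \<open>auto simp: pairwise_independent_insert independent_edges_twistI
          twist_pos_def\<close>)
  next
    case Blue
    show ?thesis unfolding Blue 2(2)
      by (rule pairwise_independent_Un_nested_pairs
            [where S = "twist_edges n Blue \<union> {{4, 5}}" and r = 2 and m = "l + 1"])
        (use 2(1) in \<open>auto simp: pairwise_independent_insert independent_edges_twistI
          twist_pos_def\<close>)
  next
    case Green
    show ?thesis unfolding Green 2(2)
      by (rule pairwise_independent_Un_nested_pairs
            [where S = "twist_edges n Green \<union> {}" and r = 0 and m = "l + 1"])
        (use 2(1) in \<open>auto simp: pairwise_independent_insert independent_edges_twistI
          twist_pos_def\<close>)
  next
    case Purple
    show ?thesis unfolding Purple 2(2)
      by (rule pairwise_independent_Un_nested_pairs
            [where S = "twist_edges n Purple \<union> {}" and r = 3 and m = "l + 1"])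
        (use 2(1) in \<open>auto simp: pairwise_independent_insert independent_edges_twistI
          twist_pos_def\<close>)
  qed
qed

section \<open>Edges of the circulant graph by the difference of their ends\<close>

text \<open>Since \<open>j + i < 2 * n\<close>, reduction modulo \<open>n\<close> subtracts
  \<open>n\<close> at most once. The residue 0 is represented by \<open>n\<close>, whence the test
  \<open>j + i \<le> n\<close>.\<close>

lemma circulant_edge_iff:
  assumes "S \<subseteq> {1..<n}"
  shows "e \<in> edges (circulant n S) \<longleftrightarrow>
    (\<exists>j \<in> {1..n}. \<exists>i \<in> S. e = {j, if j + i \<le> n then j + i else j + i - n})"
proof -
  have mod: "(j + i - 1) mod n + 1 = (if j + i \<le> n then j + i else j + i - n)"
    if "j \<in> {1..n}" "i \<in> S" for i j
  proof (cases "j + i \<le> n")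
    case True
    with that show ?thesis by simp
  next
    case False
    moreover have "i \<in> {1..<n}" using assms that(2) by blast
    ultimately have "(j + i - 1) mod n = j + i - 1 - n"
      using that(1) by (simp add: le_mod_geq)
    with False show ?thesis by simp
  qed
  have "e \<in> edges (circulant n S) \<longleftrightarrow>
    (\<exists>j \<in> {1..n}. \<exists>i \<in> S. e = {j, (j + i - 1) mod n + 1})"
    unfolding circulant_def by (simp only: ugraph.simps mem_Collect_eq) blast
  also have "\<dots> \<longleftrightarrow> (\<exists>j \<in> {1..n}. \<exists>i \<in> S. e = {j, if j + i \<le> n then j + i else j + i - n})"
    by (intro bex_cong refl) (simp only: mod)
  finally show ?thesis .
qed

lemma circulant_1_3_edge_iff:
  assumes "n \<ge> 8" and "u < v"
  shows "{u, v} \<in> edges (circulant n {1, 3}) \<longleftrightarrow>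
    1 \<le> u \<and> v \<le> n \<and> v - u \<in> {1, 3, n - 1, n - 3}"
proof -
  have "{u, v} \<in> edges (circulant n {1, 3}) \<longleftrightarrow>
    (\<exists>j \<in> {1..n}. \<exists>i \<in> {1, 3}. {u, v} = {j, if j + i \<le> n then j + i else j + i - n})"
    using assms by (intro circulant_edge_iff) auto
  also have "\<dots> \<longleftrightarrow> (\<exists>i \<in> {1, 3}. 1 \<le> u \<and> v \<le> n \<and> (v = u + i \<or> v + i = u + n))"
  proof (rule iffI; elim bexE)
    fix i j assume "j \<in> {1..n}" "i \<in> {1, 3}"
      and "{u, v} = {j, if j + i \<le> n then j + i else j + i - n}"
    with assms show "\<exists>i \<in> {1, 3}. 1 \<le> u \<and> v \<le> n \<and> (v = u + i \<or> v + i = u + n)"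
      by (intro bexI[of _ i]) (auto simp: doubleton_eq_iff split: if_splits)
  next
    fix i assume i: "i \<in> {1, 3}" and "1 \<le> u \<and> v \<le> n \<and> (v = u + i \<or> v + i = u + n)"
    \<comment> \<open>A shift that stays within \<open>n\<close> starts at the smaller end
      \<open>u\<close>; one that wraps around starts at \<open>v\<close>.\<close>
    then consider "1 \<le> u" "v \<le> n" "v = u + i" | "1 \<le> u" "v \<le> n" "v + i = u + n"
      by auto
    then show "\<exists>j \<in> {1..n}. \<exists>i \<in> {1, 3}. {u, v} = {j, if j + i \<le> n then j + i else j + i - n}"
    proof cases
      case 1
      with i assms show ?thesis
        by (intro bexI[of _ u] bexI[of _ i]) auto
    next
      case 2
      with i assms show ?thesis
        by (intro bexI[of _ v] bexI[of _ i]) auto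
    qed
  qed
  also have "\<dots> \<longleftrightarrow> 1 \<le> u \<and> v \<le> n \<and> v - u \<in> {1, 3, n - 1, n - 3}"
  proof -
    have "v = u + i \<or> v + i = u + n \<longleftrightarrow> v - u = i \<or> v - u = n - i" if "i \<le> 3" for i
      using that assms by linarith
    from this[of 1] this[of 3] show ?thesis
      by (simp only: bex_simps insert_iff empty_iff simp_thms) blast
  qed
  finally show ?thesis .
qed

lemma card_circulant_edge:
  assumes "e \<in> edges (circulant n S)" and S: "S \<subseteq> {1..<n}"
  shows "card e = 2"
proof -
  from assms(1)[unfolded circulant_edge_iff[OF S]] obtain j i
    where e: "e = {j, if j + i \<le> n then j + i else j + i - n}" and j: "j \<in> {1..n}" "i \<in> S"
    by blast
  from j(2) S have "1 \<le> i" "i < n" by auto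
  with j(1) have "j \<noteq> (if j + i \<le> n then j + i else j + i - n)" by auto
  with e show ?thesis by simp
qed

section \<open>Every edge has exactly one color\<close>

text \<open>Eliminating \<open>t\<close> leaves a congruence modulo 4 and bounds on the smaller end
  \<open>u\<close>, for the outer and the inner edge of a block. The lower bounds exclude
  \<open>t = 0\<close>.\<close>

lemma nested_pairs_edge_iff:
  assumes "u < v"
  shows "{u, v} \<in> nested_pairs r m \<longleftrightarrow>
    v = u + 3 \<and> u mod 4 = r mod 4 \<and> r + 4 \<le> u \<and> u \<le> r + 4 * m \<or>
    v = u + 1 \<and> u mod 4 = (r + 1) mod 4 \<and> r + 5 \<le> u \<and> u \<le> r + 4 * m + 1"
    (is "_ \<longleftrightarrow> ?R")
proof
  assume "{u, v} \<in> nested_pairs r m"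
  then show ?R
    using assms unfolding nested_pairs_def Let_def by (auto simp: doubleton_eq_iff)
next
  assume ?R
  then show "{u, v} \<in> nested_pairs r m"
  proof
    assume R: "v = u + 3 \<and> u mod 4 = r mod 4 \<and> r + 4 \<le> u \<and> u \<le> r + 4 * m"
    then have "4 dvd u - r" using mod_eq_dvd_iff_nat[of r u 4] by simp
    then obtain t where "u - r = 4 * t" ..
    with R have "t \<in> {1..m}" "{u, v} = {r + 4 * t, r + 4 * t + 3}" by auto
    then show ?thesis
      unfolding nested_pairs_def Let_def by blast
  next
    assume R: "v = u + 1 \<and> u mod 4 = (r + 1) mod 4 \<and> r + 5 \<le> u \<and> u \<le> r + 4 * m + 1"
    then have "4 dvd u - (r + 1)" using mod_eq_dvd_iff_nat[of "r + 1" u 4] by simp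
    then obtain t where "u - (r + 1) = 4 * t" ..
    with R have "t \<in> {1..m}" "{u, v} = {r + 4 * t + 1, r + 4 * t + 2}" by auto
    then show ?thesis
      unfolding nested_pairs_def Let_def by blast
  qed
qed

text \<open>The color of the edge with ends \<open>u < v\<close>. For \<open>n = 4k\<close> take \<open>X\<close> blue, \<open>Y\<close> green and \<open>Z\<close>
  purple; for \<open>n = 4k + 2\<close> blue and green are interchanged and \<open>Z\<close>, the color of \<open>{n - 1, n}\<close>,
  is red. The value is arbitrary if \<open>{u, v}\<close> is not an edge.\<close>

definition edge_color :: "color \<Rightarrow> color \<Rightarrow> color \<Rightarrow> nat \<Rightarrow> nat \<Rightarrow> nat \<Rightarrow> color" where
  "edge_color X Y Z n u v =
     (if v = u + 1 then
        if u = 1 \<or> u = 3 then Red else if u = 2 then Blue else if u = 4 then Y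
        else if u = n - 1 then Z else [Purple, X, Red, Y] ! (u mod 4)
      else if v = u + 3 then if u \<le> 3 then Purple else [X, Red, Y, Purple] ! (u mod 4)
      else if v = u + (n - 1) then Blue else Green)"

text \<open>One equivalence gives both that the classes cover the edges and that they are disjoint.
  The exceptions in \<open>edge_color\<close> come from the twist: by its residue
  \<open>{4, 5}\<close> would be purple, but 4 and 5 already have purple edges to 1 and 2.\<close>

lemma rest_edges_0_color_iff:
  assumes uv: "u < v" and n: "n = 4 * (l + 2)"
  shows "{u, v} \<in> twist_edges n x \<union> rest_edges_0 n (l + 2) x \<longleftrightarrow>
    (1 \<le> u \<and> v \<le> n \<and> v - u \<in> {1, 3, n - 1, n - 3}) \<and> x = edge_color Blue Green Purple n u v"
    (is "?C x \<longleftrightarrow> ?E \<and> x = ?c")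
proof
  assume "?C x"
  note F = this[unfolded n]
  show "?E \<and> x = ?c"
  proof (cases x)
    case Red
    with F uv show ?thesis unfolding n
      by (simp add: nested_pairs_edge_iff doubleton_eq_iff)
        (elim disjE conjE; simp add: edge_color_def)
  next
    case Blue
    with F uv show ?thesis unfolding n
      by (simp add: nested_pairs_edge_iff doubleton_eq_iff)
        (elim disjE conjE; simp add: edge_color_def)
  next
    case Green
    with F uv show ?thesis unfolding n
      by (simp add: nested_pairs_edge_iff doubleton_eq_iff)
        (elim disjE conjE; simp add: edge_color_def)
  next
    case Purple
    with F uv show ?thesis unfolding n
      by (simp add: nested_pairs_edge_iff doubleton_eq_iff)
        (elim disjE conjE; simp add: edge_color_def)
  qed
next
  assume E: "?E \<and> x = ?c"
  then have bounds: "1 \<le> u" "v \<le> n" by simp_all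
  from E have "v - u = 1 \<or> v - u = 3 \<or> v - u = n - 1 \<or> v - u = n - 3" by simp
  \<comment> \<open>The four differences are distinct because \<open>n \<ge> 8\<close>. For the
    first two the color depends on \<open>u mod 4\<close> apart from the exceptions; the last two
    force \<open>u \<le> 3\<close> and give only twist edges.\<close>
  with uv consider "v = u + 1" | "v = u + 3" | "v = u + (n - 1)" | "v = u + (n - 3)" by linarith
  then have "?C ?c"
  proof cases
    case 1
    have "u mod 4 = 0 \<or> u mod 4 = 1 \<or> u mod 4 = 2 \<or> u mod 4 = 3" by presburger
    then show ?thesis
      using 1 bounds unfolding n
      by (elim disjE)
        (simp_all add: nested_pairs_edge_iff doubleton_eq_iff edge_color_def, presburger+)
  next
    case 2
    have "u mod 4 = 0 \<or> u mod 4 = 1 \<or> u mod 4 = 2 \<or> u mod 4 = 3" by presburger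
    then show ?thesis
      using 2 bounds unfolding n
      by (elim disjE)
        (simp_all add: nested_pairs_edge_iff doubleton_eq_iff edge_color_def, presburger+)
  next
    case 3
    with bounds n have "u = 1" by linarith
    with 3 n show ?thesis by (simp add: edge_color_def)
  next
    case 4
    with bounds n have "u = 1 \<or> u = 2 \<or> u = 3" by linarith
    with 4 n show ?thesis by (elim disjE) (simp_all add: edge_color_def)
  qed
  with E show "?C x" by simp
qed

text \<open>As for \<open>n = 4k\<close>, the residue of \<open>n - 1\<close> would make
  \<open>{n - 1, n}\<close> green, while both ends already have green edges, to 2 and 3. The free
  color is now red.\<close>

lemma rest_edges_2_color_iff:
  assumes uv: "u < v" and n: "n = 4 * (l + 2) + 2"
  shows "{u, v} \<in> twist_edges n x \<union> rest_edges_2 n (l + 2) x \<longleftrightarrow>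
    (1 \<le> u \<and> v \<le> n \<and> v - u \<in> {1, 3, n - 1, n - 3}) \<and> x = edge_color Green Blue Red n u v"
    (is "?C x \<longleftrightarrow> ?E \<and> x = ?c")
proof
  assume "?C x"
  note F = this[unfolded n]
  show "?E \<and> x = ?c"
  proof (cases x)
    case Red
    with F uv show ?thesis unfolding n
      by (simp add: nested_pairs_edge_iff doubleton_eq_iff)
        (elim disjE conjE; simp add: edge_color_def)
  next
    case Blue
    with F uv show ?thesis unfolding n
      by (simp add: nested_pairs_edge_iff doubleton_eq_iff)
        (elim disjE conjE; simp add: edge_color_def)
  next
    case Green
    with F uv show ?thesis unfolding n
      by (simp add: nested_pairs_edge_iff doubleton_eq_iff)
        (elim disjE conjE; simp add: edge_color_def)
  next
    case Purple
    with F uv show ?thesis unfolding n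
      by (simp add: nested_pairs_edge_iff doubleton_eq_iff)
        (elim disjE conjE; simp add: edge_color_def)
  qed
next
  assume E: "?E \<and> x = ?c"
  then have bounds: "1 \<le> u" "v \<le> n" by simp_all
  from E have "v - u = 1 \<or> v - u = 3 \<or> v - u = n - 1 \<or> v - u = n - 3" by simp
  with uv consider "v = u + 1" | "v = u + 3" | "v = u + (n - 1)" | "v = u + (n - 3)" by linarith
  then have "?C ?c"
  proof cases
    case 1
    have "u mod 4 = 0 \<or> u mod 4 = 1 \<or> u mod 4 = 2 \<or> u mod 4 = 3" by presburger
    then show ?thesis
      using 1 bounds unfolding n
      by (elim disjE)
        (simp_all add: nested_pairs_edge_iff doubleton_eq_iff edge_color_def, presburger+)
  next
    case 2
    have "u mod 4 = 0 \<or> u mod 4 = 1 \<or> u mod 4 = 2 \<or> u mod 4 = 3" by presburger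
    then show ?thesis
      using 2 bounds unfolding n
      by (elim disjE)
        (simp_all add: nested_pairs_edge_iff doubleton_eq_iff edge_color_def, presburger+)
  next
    case 3
    with bounds n have "u = 1" by linarith
    with 3 n show ?thesis by (simp add: edge_color_def)
  next
    case 4
    with bounds n have "u = 1 \<or> u = 2 \<or> u = 3" by linarith
    with 4 n show ?thesis by (elim disjE) (simp_all add: edge_color_def)
  qed
  with E show "?C x" by simp
qed

lemma card_circulant_coloring_edge:
  assumes "e \<in> circulant_coloring n x" and "n \<ge> 8"
  shows "card e = 2"
proof -
  have "card e = 2" if "e \<in> nested_pairs r m" for r m
    using that by (elim nested_pairsE) auto
  moreover have "card e = 2" if "e \<in> twist_edges n x \<or> e = {4, 5} \<or> e = {n - 1, n}"
    using that \<open>n \<ge> 8\<close> by (cases x) auto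
  ultimately show ?thesis
    using assms(1) unfolding circulant_coloring_def by (cases x) (auto split: if_splits)
qed

lemma card_2_lessE:
  fixes e :: "'a :: linorder set"
  assumes "card e = 2"
  obtains u v where "u < v" and "e = {u, v}"
proof -
  from assms obtain u v where "e = {u, v}" "u \<noteq> v" by (auto simp: card_2_iff)
  then have "u < v \<or> v < u" and "e = {v, u}" by auto
  with \<open>e = {u, v}\<close> that show thesis by blast
qed

text \<open>A single color function hides the two residue classes of \<open>n\<close>: its existence
  yields the covering, its being a function the disjointness.\<close>

lemma circulant_coloring_colorE:
  assumes "n \<ge> 8" and "even n"
  obtains col where "\<And>u v x. u < v \<Longrightarrow>
    {u, v} \<in> circulant_coloring n x \<longleftrightarrow> {u, v} \<in> edges (circulant n {1, 3}) \<and> x = col u v"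
  using assms
proof (cases rule: circulant_coloring_cases)
  case (1 l)
  show thesis
    by (rule that[of "edge_color Blue Green Purple n"])
      (simp only: 1(2) rest_edges_0_color_iff[OF _ 1(1)] circulant_1_3_edge_iff[OF assms(1)])
next
  case (2 l)
  show thesis
    by (rule that[of "edge_color Green Blue Red n"])
      (simp only: 2(2) rest_edges_2_color_iff[OF _ 2(1)] circulant_1_3_edge_iff[OF assms(1)])
qed

lemma edge_coloring_circulant:
  assumes "n \<ge> 8" and "even n"
  shows "edge_coloring (circulant n {1, 3}) (circulant_coloring n)"
proof -
  obtain col where col: "\<And>u v x. u < v \<Longrightarrow>
    {u, v} \<in> circulant_coloring n x \<longleftrightarrow> {u, v} \<in> edges (circulant n {1, 3}) \<and> x = col u v"
    using assms by (rule circulant_coloring_colorE) blast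
  have union: "e \<in> edges (circulant n {1, 3}) \<longleftrightarrow> (\<exists>x. e \<in> circulant_coloring n x)" for e
  proof (cases "card e = 2")
    case True
    then show ?thesis by (rule card_2_lessE) (simp add: col)
  next
    \<comment> \<open>A set that does not have two elements is neither an edge nor a member of a
      color class.\<close>
    case False
    moreover have "{1, 3} \<subseteq> {1..<n}" using assms(1) by auto
    ultimately show ?thesis
      using assms(1) card_circulant_edge card_circulant_coloring_edge by blast
  qed
  have unique: "x = y" if e: "e \<in> circulant_coloring n x" "e \<in> circulant_coloring n y" for e x y
  proof -
    from card_circulant_coloring_edge[OF e(1) assms(1)] obtain u v where "u < v" "e = {u, v}"
      by (rule card_2_lessE)
    with e show ?thesis by (simp add: col)
  qed
  show ?thesis
    unfolding edge_coloring_def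
  proof (intro conjI allI impI)
    show "(\<Union>x. circulant_coloring n x) = edges (circulant n {1, 3})"
      by (rule set_eqI) (simp only: union UN_iff UNIV_I bex_simps simp_thms)
    fix x y :: color assume "x \<noteq> y"
    then show "circulant_coloring n x \<inter> circulant_coloring n y = {}"
      using unique[of _ x y] by blast
  qed
qed

section \<open>The maximum degree\<close>

text \<open>Edges at \<open>v\<close> meet, so they have different colors; choosing a color for each
  edge is injective on them.\<close>

lemma degree_le_card_colors:
  fixes C :: "'c \<Rightarrow> 'a set set"
  assumes "edge_coloring G C" and "\<And>x e f. e \<in> C x \<Longrightarrow> f \<in> C x \<Longrightarrow> e \<noteq> f \<Longrightarrow> e \<inter> f = {}"
    and "finite {x. C x \<noteq> {}}"
  shows "degree G v \<le> card {x. C x \<noteq> {}}"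
proof -
  define col where "col e = (SOME x. e \<in> C x)" for e
  have col: "e \<in> C (col e)" if "e \<in> edges G" for e
  proof -
    have "\<exists>x. e \<in> C x" using that assms(1) unfolding edge_coloring_def by blast
    then show ?thesis unfolding col_def by (rule someI_ex)
  qed
  have "inj_on col {e \<in> edges G. v \<in> e}"
  proof (rule inj_onI)
    fix e f assume ef: "e \<in> {e \<in> edges G. v \<in> e}" "f \<in> {e \<in> edges G. v \<in> e}" "col e = col f"
    then have "e \<in> C (col e)" "f \<in> C (col e)" using col[of e] col[of f] by auto
    with ef assms(2)[of e "col e" f] show "e = f" by blast
  qed
  moreover have "col ` {e \<in> edges G. v \<in> e} \<subseteq> {x. C x \<noteq> {}}"
    using col by blast
  ultimately show ?thesis
    unfolding degree_def using assms(3) by (intro card_inj_on_le)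
qed

theorem theorem1:
  fixes n :: nat
  assumes "n \<ge> 8" and "even n"
  shows "dispersable (circulant n {1, 3}) (twist_order n) (circulant_coloring n)"
proof -
  let ?G = "circulant n {1, 3}" and ?C = "circulant_coloring n"
  have verts: "verts ?G = {1..n}" by (simp add: circulant_def)
  have edge: "e \<subseteq> {1..n} \<and> card e = 2" if e: "e \<in> edges ?G" for e
  proof -
    have "{1, 3} \<subseteq> {1..<n}" using assms(1) by auto
    from card_circulant_edge[OF e this] obtain u v where uv: "u < v" "e = {u, v}"
      by (rule card_2_lessE)
    with e assms circulant_1_3_edge_iff[of n u v] show ?thesis by auto
  qed
  have "edges ?G \<subseteq> Pow {1..n}" using edge by blast
  then have fin_edges: "finite (edges ?G)"
    by (rule finite_subset) simp
  have "simple_graph ?G"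
    unfolding simple_graph_def verts using edge finite_atLeastAtMost by blast
  moreover have "cyclic_order_on (verts ?G) (twist_order n)"
    unfolding verts using assms(1) by (intro cyclic_order_twist) simp
  moreover have col: "edge_coloring ?G ?C"
    using assms by (rule edge_coloring_circulant)
  moreover have indep: "\<not> edges_cross (twist_order n) e f \<and> e \<inter> f = {}"
    if "e \<in> ?C x" "f \<in> ?C x" "e \<noteq> f" for x e f
    using pairwise_independent_circulant_coloring[OF assms] that
    by (auto simp: pairwise_def independent_edges_def)
  ultimately have "matching_book_embedding ?G (twist_order n) ?C"
    unfolding matching_book_embedding_def by blast
  moreover have "card {x. ?C x \<noteq> {}} = max_degree ?G"
  proof -
    have UNIV: "(UNIV :: color set) = {Red, Blue, Green, Purple}"
      using color.exhaust by auto
    \<comment> \<open>The twist already uses all four colors.\<close>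
    have "twist_edges n x \<noteq> {}" for x by (cases x) auto
    then have "{x. ?C x \<noteq> {}} = {Red, Blue, Green, Purple}"
      unfolding UNIV[symmetric] circulant_coloring_def by auto
    then have card: "card {x. ?C x \<noteq> {}} = 4" and fin: "finite {x. ?C x \<noteq> {}}" by simp_all
    have le: "degree ?G v \<le> 4" for v
      using degree_le_card_colors[OF col _ fin, of v] indep card by simp
    \<comment> \<open>These are the neighbors of 1 by the differences 1, 3, \<open>n - 1\<close> and
      \<open>n - 3\<close>; they are distinct because \<open>n \<ge> 8\<close>.\<close>
    have "{1, w} \<in> edges ?G" if "w \<in> {2, 4, n, n - 2}" for w
      using that assms(1) circulant_1_3_edge_iff[OF assms(1), of 1 w] by auto
    then have "{{1, 2}, {1, 4}, {1, n}, {1, n - 2}} \<subseteq> {e \<in> edges ?G. 1 \<in> e}"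
      by blast
    then have "card {{1, 2}, {1, 4}, {1, n}, {1, n - 2}} \<le> degree ?G 1"
      unfolding degree_def using fin_edges
      by (intro card_mono finite_Collect_conjI disjI1) (simp_all only: Collect_mem_eq)
    moreover have "card {{1, 2}, {1, 4}, {1, n}, {1, n - 2}} = 4"
      using assms by (auto simp: card_insert_if doubleton_eq_iff)
    ultimately have four: "4 = degree ?G 1" using le[of 1] by linarith
    have "max_degree ?G = 4"
      unfolding max_degree_def
    proof (rule Max_eqI)
      show "finite (degree ?G ` verts ?G)" unfolding verts by blast
      show "d \<le> 4" if "d \<in> degree ?G ` verts ?G" for d using that le by blast
      show "4 \<in> degree ?G ` verts ?G"
        unfolding verts four by (rule imageI) (use assms(1) in simp)
    qed
    with card show ?thesis by simp
  qed
  ultimately show ?thesis unfolding dispersable_def by blast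
qed

end
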